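(* Let $0<p\le 1/2$ be fixed. For any $0<\varepsilon<p^2$, almost all oriented graphs $D\in\overrightarrow{G}(n,p)$ satisfy $\pi_2(D)\ge (p^2-\varepsilon)n$; that is, the probability that a random $D\in \overrightarrow{G}(n,p)$ satisfies $\pi_2(D)\ge (p^2-\varepsilon)n$ tends to $1$ as $n\to\infty$.
   Context: For $0\le p\le 1/2$, $\overrightarrow{G}(n,p)$ is the random oriented graph on $n$ labelled vertices in which, independently for each vertex pair $\{u,v\}$, the arc $uv$ is present with probability $p$, the arc $vu$ is present with probability $p$, and no arc joins $u$ and $v$ with probability $1-2p$. For distinct vertices $u,v$ of $D$, $p_2(u,v)$ is the number of directed paths of length $2$ from $u$ to $v$ (i.e. vertices $w$ with arcs $uw$ and $wv$), and $\pi_2(D)=\min\{p_2(u,v): u,v\in V(D), u\ne v\}$. *)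

theory Defs
  imports "HOL-Probability.Probability" "Graph_Theory.Pair_Digraph"
begin

definition random_arc :: "real \<Rightarrow> 'a \<Rightarrow> 'a \<Rightarrow> 'a rel pmf" where
  "random_arc p u v = pmf_of_list [({(u, v)}, p), ({(v, u)}, p), ({}, 1 - 2 * p)]"

text \<open>
  The list above is a probability distribution only for \<open>0 \<le> p \<le> 1/2\<close>.
\<close>

lemma pmf_random_arc:
  assumes "0 \<le> p" "p \<le> 1 / 2" "u \<noteq> v"
  shows "pmf (random_arc p u v) {(u, v)} = p"
    and "pmf (random_arc p u v) {(v, u)} = p"
    and "pmf (random_arc p u v) {} = 1 - 2 * p"
proof -
  have "pmf_of_list_wf [({(u, v)}, p), ({(v, u)}, p), ({}, 1 - 2 * p)]"
    using assms by (intro pmf_of_list_wfI) auto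
  then show "pmf (random_arc p u v) {(u, v)} = p"
    and "pmf (random_arc p u v) {(v, u)} = p"
    and "pmf (random_arc p u v) {} = 1 - 2 * p"
    using assms by (auto simp: random_arc_def pmf_pmf_of_list)
qed

text \<open>
  The vertex set is \<open>{0, \<dots>, n - 1}\<close>, and the unordered pair of distinct vertices \<open>u\<close>, \<open>v\<close>
  is represented by \<open>(u, v)\<close> with \<open>u < v\<close>.
\<close>

definition vertex_pairs :: "nat \<Rightarrow> (nat \<times> nat) set" where
  "vertex_pairs n = {(u, v). u < v \<and> v < n}"

definition random_oriented_graph :: "nat \<Rightarrow> real \<Rightarrow> nat pair_pre_digraph pmf" where
  "random_oriented_graph n p =
     map_pmf (\<lambda>X. \<lparr>pverts = {..<n}, parcs = (\<Union>e\<in>vertex_pairs n. X e)\<rparr>)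
       (Pi_pmf (vertex_pairs n) {} (\<lambda>(u, v). random_arc p u v))"

definition num_paths2 :: "'a pair_pre_digraph \<Rightarrow> 'a \<Rightarrow> 'a \<Rightarrow> nat" where
  "num_paths2 D u v = card {w \<in> pverts D. (u, w) \<in> parcs D \<and> (w, v) \<in> parcs D}"

text \<open>
  The minimum is taken over a nonempty set only if \<open>D\<close> has at least two vertices.
\<close>

definition min_paths2 :: "'a pair_pre_digraph \<Rightarrow> nat" where
  "min_paths2 D = Min {num_paths2 D u v | u v. u \<in> pverts D \<and> v \<in> pverts D \<and> u \<noteq> v}"

end

theory Submission
  imports Defs "HOL-Real_Asymp.Real_Asymp"
begin

text \<open>
  Fix \<open>u \<noteq> v\<close>. The events that \<open>w\<close> is the midpoint of a path from \<open>u\<close> to \<open>v\<close> have probability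
  \<open>p\<^sup>2\<close> and are independent for the \<open>n - 2\<close> admissible \<open>w\<close>, since they depend on disjoint sets of
  vertex pairs. By Hoeffding's inequality, \<open>u\<close> and \<open>v\<close> are joined by fewer than \<open>(p\<^sup>2 - \<epsilon>) n\<close>
  paths with probability at most \<open>exp (- \<epsilon>\<^sup>2 n / 2)\<close>, which beats the factor \<open>n\<^sup>2\<close> of the
  union bound over all \<open>u\<close> and \<open>v\<close>.
\<close>

text \<open>The coordinate of the product space that decides both arcs between \<open>u\<close> and
  \<open>v\<close>, whichever of the two is larger.\<close>

definition ordered_pair :: "nat \<Rightarrow> nat \<Rightarrow> nat \<times> nat" where
  "ordered_pair u v = (min u v, max u v)"

lemma ordered_pair_eq_iff:
  "ordered_pair a b = ordered_pair c d \<longleftrightarrow> (a = c \<and> b = d) \<or> (a = d \<and> b = c)"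
  by (auto simp: ordered_pair_def min_def max_def split: if_splits)

lemma ordered_pair_in_vertex_pairs:
  "u < n \<Longrightarrow> v < n \<Longrightarrow> u \<noteq> v \<Longrightarrow> ordered_pair u v \<in> vertex_pairs n"
  by (auto simp: ordered_pair_def vertex_pairs_def)

lemma finite_vertex_pairs [simp]: "finite (vertex_pairs n)"
  by (rule finite_subset[of _ "{..<n} \<times> {..<n}"]) (auto simp: vertex_pairs_def)

lemma prob_arc_random_arc:
  assumes "0 \<le> p" "p \<le> 1 / 2" "u \<noteq> v"
  shows "measure_pmf.prob (random_arc p u v) {S. (u, v) \<in> S} = p"
    and "measure_pmf.prob (random_arc p u v) {S. (v, u) \<in> S} = p"
proof -
  have "pmf_of_list_wf [({(u, v)}, p), ({(v, u)}, p), ({}, 1 - 2 * p)]"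
    using assms by (intro pmf_of_list_wfI) auto
  then show "measure_pmf.prob (random_arc p u v) {S. (u, v) \<in> S} = p"
    and "measure_pmf.prob (random_arc p u v) {S. (v, u) \<in> S} = p"
    using assms by (auto simp: random_arc_def measure_pmf_of_list)
qed

text \<open>Both orientations of a pair are equally likely, so sorting its ends does not affect the
  probability.\<close>

lemma prob_arc_ordered_pair:
  assumes "0 \<le> p" "p \<le> 1 / 2" "u \<noteq> v"
  shows "measure_pmf.prob (case ordered_pair u v of (a, b) \<Rightarrow> random_arc p a b) {S. (u, v) \<in> S} = p"
  using assms prob_arc_random_arc[of p u v] prob_arc_random_arc[of p v u]
  by (auto simp: ordered_pair_def min_def max_def)

text \<open>A condition on the family of pairwise choices rather than on the digraph, so that the
  coordinates it reads are explicit.\<close>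

definition midpoint :: "nat \<Rightarrow> nat \<Rightarrow> (nat \<times> nat \<Rightarrow> nat rel) \<Rightarrow> nat \<Rightarrow> bool" where
  "midpoint u v X w \<longleftrightarrow> (u, w) \<in> X (ordered_pair u w) \<and> (w, v) \<in> X (ordered_pair w v)"

abbreviation random_arcs :: "nat \<Rightarrow> real \<Rightarrow> (nat \<times> nat \<Rightarrow> nat rel) pmf" where
  "random_arcs n p \<equiv> Pi_pmf (vertex_pairs n) {} (\<lambda>(u, v). random_arc p u v)"

lemma prob_midpoint:
  assumes p: "0 \<le> p" "p \<le> 1 / 2"
    and uv: "u < n" "v < n" "w < n" "u \<noteq> v" "w \<noteq> u" "w \<noteq> v"
  shows "measure_pmf.prob (random_arcs n p) {X. midpoint u v X w} = p\<^sup>2"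
proof -
  let ?e = "ordered_pair u w" and ?f = "ordered_pair w v"
  let ?A = "vertex_pairs n"
  \<comment> \<open>The event as a box: constraints at two coordinates, which differ because
    \<open>u \<noteq> v\<close>, and none elsewhere. Its probability is thus a product in which the
    other factors are 1.\<close>
  define B where "B e = (if e = ?e then {S. (u, w) \<in> S} else if e = ?f then {S. (w, v) \<in> S} else UNIV)"
    for e
  let ?g = "\<lambda>e. measure_pmf.prob (case e of (a, b) \<Rightarrow> random_arc p a b) (B e)"
  have ef: "?e \<in> ?A" "?f \<in> ?A" "?e \<noteq> ?f"
    using uv by (auto simp: ordered_pair_in_vertex_pairs ordered_pair_eq_iff)
  then have "{X. midpoint u v X w} = Pi ?A B"
    by (auto simp del: split_paired_All simp: midpoint_def B_def Pi_def)
  then have "measure_pmf.prob (random_arcs n p) {X. midpoint u v X w} = prod ?g ?A"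
    by (simp add: measure_Pi_pmf_Pi)
  also have "\<dots> = prod ?g {?e, ?f}"
    using ef by (intro prod.mono_neutral_right) (auto simp: B_def)
  also have "\<dots> = p\<^sup>2"
    using ef p uv by (simp add: B_def prob_arc_ordered_pair power2_eq_square)
  finally show ?thesis .
qed

lemma indep_midpoint:
  assumes uv: "u < n" "v < n" "u \<noteq> v"
  shows "prob_space.indep_vars (measure_pmf (random_arcs n p)) (\<lambda>_. borel)
           (\<lambda>w X. of_bool (midpoint u v X w) :: real) ({..<n} - {u, v})"
proof -
  let ?W = "{..<n} - {u, v}"
  \<comment> \<open>The coordinates that decide whether \<open>w\<close> is a midpoint. Blocks of
    distinct vertices are disjoint: for instance,
    \<open>ordered_pair u w = ordered_pair w' v\<close> would force \<open>w = v\<close> or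
    \<open>u = v\<close>.\<close>
  define K where "K w = {ordered_pair u w, ordered_pair w v}" for w
  have "prob_space.indep_vars (measure_pmf (random_arcs n p)) (\<lambda>w. PiM (K w) (\<lambda>_. count_space UNIV))
      (\<lambda>w X. restrict (\<lambda>e. X e) (K w)) ?W"
  proof (rule prob_space.indep_vars_restrict[OF measure_pmf.prob_space_axioms indep_vars_Pi_pmf])
    show "K w \<subseteq> vertex_pairs n" if "w \<in> ?W" for w
      using that uv by (auto simp: K_def ordered_pair_in_vertex_pairs)
    show "disjoint_family_on K ?W"
      using uv by (auto simp: disjoint_family_on_def K_def ordered_pair_eq_iff)
  qed auto
  \<comment> \<open>Independence of the blocks passes to functions of them, once
    \<open>midpoint\<close> is measurable in the coordinates of its block.\<close>
  from prob_space.indep_vars_compose2[OF measure_pmf.prob_space_axioms this]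
  have "prob_space.indep_vars (measure_pmf (random_arcs n p)) (\<lambda>_. borel)
      (\<lambda>w X. of_bool (midpoint u v (restrict (\<lambda>e. X e) (K w)) w) :: real) ?W"
  proof this
    fix w
    have arc: "Measurable.pred (PiM (K w) (\<lambda>_. count_space UNIV)) (\<lambda>X. a \<in> X e)"
      if "e \<in> K w" for a :: "nat \<times> nat" and e
      using that by (rule measurable_compose[OF measurable_component_singleton]) simp
    have [measurable]:
      "Measurable.pred (PiM (K w) (\<lambda>_. count_space UNIV)) (\<lambda>X. midpoint u v X w)"
      unfolding midpoint_def by (intro pred_intros_logic arc) (auto simp: K_def)
    show "(\<lambda>X. of_bool (midpoint u v X w) :: real)
        \<in> borel_measurable (PiM (K w) (\<lambda>_. count_space UNIV))"
      by measurable
  qed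
  moreover have "midpoint u v (restrict (\<lambda>e. X e) (K w)) w = midpoint u v X w" for X w
    by (simp add: midpoint_def K_def)
  ultimately show ?thesis
    by simp
qed

lemma prob_few_midpoints:
  assumes p: "0 \<le> p" "p \<le> 1 / 2" and n: "n \<ge> 3"
    and uv: "u < n" "v < n" "u \<noteq> v" and \<delta>: "\<delta> \<ge> 0"
  shows "measure_pmf.prob (random_arcs n p)
           {X. real (card {w \<in> {..<n} - {u, v}. midpoint u v X w}) \<le> real (n - 2) * p\<^sup>2 - \<delta>}
         \<le> exp (- 2 * \<delta>\<^sup>2 / real (n - 2))"
proof -
  let ?W = "{..<n} - {u, v}"
  let ?Z = "\<lambda>w X. of_bool (midpoint u v X w) :: real"
  have card_W: "card ?W = n - 2"
    using uv by (simp add: card_Diff_subset)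
  \<comment> \<open>The summands lie in [0, 1], so the denominator in Hoeffding's bound is their
    number \<open>n - 2\<close>, which \<open>n \<ge> 3\<close> makes positive.\<close>
  interpret Hoeffding_ineq "measure_pmf (random_arcs n p)" ?W ?Z "\<lambda>_. 0" "\<lambda>_. 1"
      "\<Sum>w\<in>?W. measure_pmf.expectation (random_arcs n p) (?Z w)"
    by unfold_locales (auto intro!: indep_midpoint uv)
  have "measure_pmf.expectation (random_arcs n p) (?Z w) = p\<^sup>2" if "w \<in> ?W" for w
  proof -
    have "?Z w = indicator {X. midpoint u v X w}"
      by (auto simp: indicator_def)
    then show ?thesis
      using that p uv by (simp add: prob_midpoint)
  qed
  then have "(\<Sum>w\<in>?W. measure_pmf.expectation (random_arcs n p) (?Z w)) = real (n - 2) * p\<^sup>2"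
    by (simp add: card_W)
  moreover have "(\<Sum>w\<in>?W. ?Z w X) = real (card {w \<in> ?W. midpoint u v X w})" for X
    by (simp add: sum.If_cases of_bool_def Int_def)
  ultimately show ?thesis
    using Hoeffding_ineq_le[OF \<delta>] n by (simp add: card_W)
qed

text \<open>Only an inequality, since an arbitrary \<open>X\<close> may also place an arc in the
  coordinate of another pair. Path counts have to be bounded only from below.\<close>

lemma card_midpoints_le_num_paths2:
  assumes "u < n" "v < n"
  shows "card {w \<in> {..<n} - {u, v}. midpoint u v X w}
         \<le> num_paths2 \<lparr>pverts = {..<n}, parcs = (\<Union>e\<in>vertex_pairs n. X e)\<rparr> u v"
  unfolding num_paths2_def
proof (rule card_mono)
  show "{w \<in> {..<n} - {u, v}. midpoint u v X w}
      \<subseteq> {w \<in> pverts \<lparr>pverts = {..<n}, parcs = (\<Union>e\<in>vertex_pairs n. X e)\<rparr>.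
           (u, w) \<in> parcs \<lparr>pverts = {..<n}, parcs = (\<Union>e\<in>vertex_pairs n. X e)\<rparr> \<and>
           (w, v) \<in> parcs \<lparr>pverts = {..<n}, parcs = (\<Union>e\<in>vertex_pairs n. X e)\<rparr>}"
    using assms by (auto simp: midpoint_def intro!: bexI[OF _ ordered_pair_in_vertex_pairs])
qed simp

text \<open>Traces a small minimum back to a specific pair. Finiteness and two distinct vertices
  make \<open>Min\<close> range over a finite nonempty set.\<close>

lemma min_paths2_attained:
  assumes "finite (pverts D)" "a \<in> pverts D" "b \<in> pverts D" "a \<noteq> b"
  obtains u v where "u \<in> pverts D" "v \<in> pverts D" "u \<noteq> v" "min_paths2 D = num_paths2 D u v"
proof -
  let ?S = "{num_paths2 D u v | u v. u \<in> pverts D \<and> v \<in> pverts D \<and> u \<noteq> v}"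
  have "?S \<subseteq> (\<lambda>(u, v). num_paths2 D u v) ` (pverts D \<times> pverts D)"
    by auto
  then have "finite ?S"
    by (rule finite_subset) (simp add: assms(1))
  moreover have "?S \<noteq> {}"
    using assms(2-) by auto
  ultimately have "min_paths2 D \<in> ?S"
    unfolding min_paths2_def by (rule Min_in)
  then show thesis
    using that by auto
qed

lemma prob_min_paths2_less:
  assumes p: "0 \<le> p" "p \<le> 1 / 2" and \<epsilon>: "0 < \<epsilon>" and n: "n \<ge> 3" "real n * \<epsilon> \<ge> 1"
  shows "measure_pmf.prob (random_oriented_graph n p) {D. real (min_paths2 D) < (p\<^sup>2 - \<epsilon>) * real n}
         \<le> (real n)\<^sup>2 * exp (- \<epsilon>\<^sup>2 * real n / 2)"
proof -
  define G :: "(nat \<times> nat \<Rightarrow> nat rel) \<Rightarrow> nat pair_pre_digraph"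
    where "G X = \<lparr>pverts = {..<n}, parcs = (\<Union>e\<in>vertex_pairs n. X e)\<rparr>" for X
  \<comment> \<open>Half of the slack \<open>\<epsilon> * real n\<close> goes to the deviation; the
    other half pays for having \<open>n - 2\<close> instead of \<open>n\<close> candidate
    midpoints.\<close>
  define \<delta> where "\<delta> = \<epsilon> * real n / 2"
  define Bad where "Bad u v =
      {X. real (card {w \<in> {..<n} - {u, v}. midpoint u v X w}) \<le> real (n - 2) * p\<^sup>2 - \<delta>}" for u v
  let ?P = "{(u, v). u < n \<and> v < n \<and> u \<noteq> v}"
  have P: "?P \<subseteq> {..<n} \<times> {..<n}"
    by auto
  then have fin_P: "finite ?P"
    by (rule finite_subset) simp
  have card_P: "real (card ?P) \<le> (real n)\<^sup>2"
    using card_mono[OF _ P] by (simp add: power2_eq_square flip: of_nat_mult)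
  \<comment> \<open>The two missing candidates cost \<open>2 * p\<^sup>2 \<le> 1 / 2\<close>, while
    the reserved half of the slack is at least \<open>1 / 2\<close>.\<close>
  have "p\<^sup>2 \<le> (1 / 2)\<^sup>2"
    using p by (intro power_mono) auto
  then have threshold: "(p\<^sup>2 - \<epsilon>) * real n \<le> real (n - 2) * p\<^sup>2 - \<delta>"
    using n by (simp add: \<delta>_def of_nat_diff field_simps power2_eq_square)
  have sub: "{X. real (min_paths2 (G X)) < (p\<^sup>2 - \<epsilon>) * real n} \<subseteq> (\<Union>(u, v)\<in>?P. Bad u v)"
  proof
    fix X assume "X \<in> {X. real (min_paths2 (G X)) < (p\<^sup>2 - \<epsilon>) * real n}"
    then have less: "real (min_paths2 (G X)) < (p\<^sup>2 - \<epsilon>) * real n"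
      by simp
    have "finite (pverts (G X))" "0 \<in> pverts (G X)" "1 \<in> pverts (G X)" "(0::nat) \<noteq> 1"
      using n by (auto simp: G_def)
    then obtain u v where "u \<in> pverts (G X)" "v \<in> pverts (G X)" "u \<noteq> v"
      and uv: "min_paths2 (G X) = num_paths2 (G X) u v"
      by (rule min_paths2_attained)
    then have "(u, v) \<in> ?P"
      by (simp add: G_def)
    moreover have "X \<in> Bad u v"
      using \<open>(u, v) \<in> ?P\<close> less threshold card_midpoints_le_num_paths2[of u n v X] uv
      by (simp add: Bad_def G_def)
    ultimately show "X \<in> (\<Union>(u, v)\<in>?P. Bad u v)"
      by blast
  qed
  \<comment> \<open>The left side is \<open>2 * \<delta>\<^sup>2 / real n\<close>: a larger
    denominator only weakens the bound.\<close>
  have "\<epsilon>\<^sup>2 * real n / 2 \<le> 2 * \<delta>\<^sup>2 / real (n - 2)"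
    using n \<epsilon> by (simp add: \<delta>_def of_nat_diff field_simps power2_eq_square)
  then have exp_le: "exp (- 2 * \<delta>\<^sup>2 / real (n - 2)) \<le> exp (- \<epsilon>\<^sup>2 * real n / 2)"
    by simp
  \<comment> \<open>The random graph is the image of the product distribution under
    \<open>G\<close>, so its events pull back.\<close>
  have "measure_pmf.prob (random_oriented_graph n p) {D. real (min_paths2 D) < (p\<^sup>2 - \<epsilon>) * real n}
      = measure_pmf.prob (random_arcs n p) {X. real (min_paths2 (G X)) < (p\<^sup>2 - \<epsilon>) * real n}"
    by (simp add: random_oriented_graph_def G_def vimage_def)
  also have "\<dots> \<le> measure_pmf.prob (random_arcs n p) (\<Union>(u, v)\<in>?P. Bad u v)"
    using sub by (intro measure_pmf.finite_measure_mono) auto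
  also have "\<dots> \<le> (\<Sum>e\<in>?P. measure_pmf.prob (random_arcs n p) (case e of (u, v) \<Rightarrow> Bad u v))"
    using fin_P by (intro measure_UNION_le) auto
  also have "\<dots> \<le> (\<Sum>e\<in>?P. exp (- \<epsilon>\<^sup>2 * real n / 2))"
  proof (rule sum_mono, clarify)
    fix u v assume "u < n" "v < n" "u \<noteq> v"
    then have "measure_pmf.prob (random_arcs n p) (Bad u v) \<le> exp (- 2 * \<delta>\<^sup>2 / real (n - 2))"
      unfolding Bad_def using p n \<epsilon> by (intro prob_few_midpoints) (auto simp: \<delta>_def)
    then show "measure_pmf.prob (random_arcs n p) (Bad u v) \<le> exp (- \<epsilon>\<^sup>2 * real n / 2)"
      using exp_le by linarith
  qed
  also have "\<dots> \<le> (real n)\<^sup>2 * exp (- \<epsilon>\<^sup>2 * real n / 2)"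
    using card_P by (simp add: mult_right_mono)
  finally show ?thesis .
qed

theorem theorem10:
  fixes p \<epsilon> :: real
  assumes "0 < p" "p \<le> 1 / 2" "0 < \<epsilon>" "\<epsilon> < p\<^sup>2"
  shows "(\<lambda>n. measure_pmf.prob (random_oriented_graph n p)
            {D. real (min_paths2 D) \<ge> (p\<^sup>2 - \<epsilon>) * real n}) \<longlonglongrightarrow> 1"
proof (rule tendsto_sandwich)
  show "\<forall>\<^sub>F n in sequentially. 1 - (real n)\<^sup>2 * exp (- \<epsilon>\<^sup>2 * real n / 2)
      \<le> measure_pmf.prob (random_oriented_graph n p) {D. real (min_paths2 D) \<ge> (p\<^sup>2 - \<epsilon>) * real n}"
    \<comment> \<open>Ensures \<open>n \<ge> 3\<close> and
      \<open>real n * \<epsilon> \<ge> 1\<close>, as the tail bound requires.\<close>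
    using eventually_ge_at_top[of "max 3 (nat \<lceil>1 / \<epsilon>\<rceil>)"]
  proof eventually_elim
    case (elim n)
    then have "1 / \<epsilon> \<le> real n"
      by linarith
    then have "1 \<le> real n * \<epsilon>"
      using assms by (simp add: field_simps)
    let ?good = "{D. real (min_paths2 D) \<ge> (p\<^sup>2 - \<epsilon>) * real n}"
    have "1 - measure_pmf.prob (random_oriented_graph n p) ?good
        = measure_pmf.prob (random_oriented_graph n p) (UNIV - ?good)"
      using measure_pmf.prob_compl[of ?good "random_oriented_graph n p"] by simp
    also have "UNIV - ?good = {D. real (min_paths2 D) < (p\<^sup>2 - \<epsilon>) * real n}"
      by auto
    also have "measure_pmf.prob (random_oriented_graph n p) \<dots>
        \<le> (real n)\<^sup>2 * exp (- \<epsilon>\<^sup>2 * real n / 2)"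
      using assms elim \<open>1 \<le> real n * \<epsilon>\<close> by (intro prob_min_paths2_less) auto
    finally show ?case
      by linarith
  qed
  show "(\<lambda>n. 1 - (real n)\<^sup>2 * exp (- \<epsilon>\<^sup>2 * real n / 2)) \<longlonglongrightarrow> 1"
    using assms by real_asymp
\<comment> \<open>The upper side of the sandwich is the constant 1, which bounds every
  probability.\<close>
qed auto

end
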